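(* Let $S \subset \mathrm{Alt}(\mathbf N)$ be a generating set such that $S^A_{\mathbf N} \subset S \subset T^A_{\mathbf N}$. Then $$C_{\mathrm{Alt}(\mathbf N), S}(q) = \Big(\sum_{u=0}^\infty p(u) q^u\Big)\Big( \sum_{v=0}^\infty p_e(v) q^v\Big) = \frac{1}{2} \prod_{j=1}^\infty \frac{1}{(1-q^j)^2} + \frac{1}{2} \prod_{j=1}^\infty \frac{1}{1-q^{2j}}$$ $$= 1+q+3q^2+5q^3+11q^4+18q^5+34q^6+55q^7+95q^8+150q^9+244q^{10} + \cdots.$$
   Context: $\mathbf N = \{0,1,2,\dots\}$. For a group $G$ generated by a set $S$: the word length $\ell_{G,S}(g)$ is the smallest $n \ge 0$ such that $g = s_1 \cdots s_n$ with $s_i \in S \cup S^{-1}$; the conjugacy length $\kappa_{G,S}(g)$ is the minimum of $\ell_{G,S}(h)$ over all $h$ in the conjugacy class of $g$; $\gamma_{G,S}(n)$ is the number of conjugacy classes of $G$ consisting of elements $g$ with $\kappa_{G,S}(g) = n$. When $\gamma_{G,S}(n)$ is finite for all $n$, the conjugacy growth series is $C_{G,S}(q) = \sum_{n=0}^\infty \gamma_{G,S}(n) q^n$. (Asserting a formula for $C_{G,S}$ includes the assertion that all $\gamma_{G,S}(n)$ are finite.) $\mathrm{Alt}(\mathbf N)$ is the finitary alternating group of $\mathbf N$: the group of permutations of $\mathbf N$ with finite support and even signature. $S^A_{\mathbf N} = \{(i,i+1,i+2) \mid i \in \mathbf N\}$, and $T^A_{\mathbf N}$ is the set of all $3$-cycles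 in $\mathrm{Alt}(\mathbf N)$. $p(u)$ is the number of partitions of $u$ (with $p(0)=1$), and $p_e(v)$ is the number of partitions of $v$ having an even number of positive parts (with $p_e(0) = 1$). *)

theory Defs
  imports "HOL-Analysis.Infinite_Products" "HOL-Computational_Algebra.Formal_Power_Series"
    "HOL-Algebra.Sym_Groups" "HOL-Algebra.Group_Action" "HOL-Library.Multiset"
begin

definition word_length :: "('a, 'b) monoid_scheme \<Rightarrow> 'a set \<Rightarrow> 'a \<Rightarrow> nat" where
  "word_length G S g =
    (LEAST n. \<exists>ws. length ws = n \<and> set ws \<subseteq> S \<union> m_inv G ` S \<and>
       foldr (\<otimes>\<^bsub>G\<^esub>) ws \<one>\<^bsub>G\<^esub> = g)"

definition conj_action :: "('a, 'b) monoid_scheme \<Rightarrow> 'a \<Rightarrow> 'a \<Rightarrow> 'a" where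
  "conj_action G = (\<lambda>x. \<lambda>g \<in> carrier G. x \<otimes>\<^bsub>G\<^esub> g \<otimes>\<^bsub>G\<^esub> inv\<^bsub>G\<^esub> x)"

definition conj_class :: "('a, 'b) monoid_scheme \<Rightarrow> 'a \<Rightarrow> 'a set" where
  "conj_class G g = orbit G (conj_action G) g"

definition conj_classes :: "('a, 'b) monoid_scheme \<Rightarrow> 'a set set" where
  "conj_classes G = orbits G (carrier G) (conj_action G)"

definition conj_length :: "('a, 'b) monoid_scheme \<Rightarrow> 'a set \<Rightarrow> 'a \<Rightarrow> nat" where
  "conj_length G S g = (LEAST n. \<exists>h \<in> conj_class G g. word_length G S h = n)"

definition conj_classes_of_length :: "('a, 'b) monoid_scheme \<Rightarrow> 'a set \<Rightarrow> nat \<Rightarrow> 'a set set" where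
  "conj_classes_of_length G S n = {K \<in> conj_classes G. \<forall>g \<in> K. conj_length G S g = n}"

text \<open>The coefficients below are only meaningful when \<open>conj_classes_of_length G S n\<close> is finite
  for every \<open>n\<close> (the cardinality of an infinite set is \<open>0\<close>); statements about the
  series therefore assert this finiteness separately.\<close>

definition conj_growth_series :: "('a, 'b) monoid_scheme \<Rightarrow> 'a set \<Rightarrow> rat fps" where
  "conj_growth_series G S = Abs_fps (\<lambda>n. of_nat (card (conj_classes_of_length G S n)))"

text \<open>\<open>permutation p\<close> says that \<open>p\<close> is a finite product of transpositions,
  equivalently a bijection with finite support.\<close>

definition Alt_N :: "(nat \<Rightarrow> nat) monoid" where
  "Alt_N = \<lparr> carrier = {p. permutation p \<and> evenperm p}, mult = (\<circ>), one = id \<rparr>"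

lemma Alt_N_is_group: "group Alt_N"
proof (rule groupI)
  fix p assume "p \<in> carrier Alt_N"
  then have p: "permutation p" "evenperm p"
    by (simp_all add: Alt_N_def)
  have "inv' p \<in> carrier Alt_N"
    using p by (simp add: Alt_N_def permutation_inverse evenperm_inv)
  moreover have "inv' p \<otimes>\<^bsub>Alt_N\<^esub> p = \<one>\<^bsub>Alt_N\<^esub>"
    using p by (simp add: Alt_N_def permutation_inverse_works)
  ultimately show "\<exists>y\<in>carrier Alt_N. y \<otimes>\<^bsub>Alt_N\<^esub> p = \<one>\<^bsub>Alt_N\<^esub>" by blast
qed (auto simp: Alt_N_def permutation_compose evenperm_comp comp_assoc)

definition S_Alt_N :: "(nat \<Rightarrow> nat) set" where
  "S_Alt_N = {cycle_of_list [i, i + 1, i + 2] | i. True}"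

definition T_Alt_N :: "(nat \<Rightarrow> nat) set" where
  "T_Alt_N = {cycle_of_list cs | cs. cycle cs \<and> length cs = 3}"

text \<open>A partition of \<open>n\<close> is the multiset of its positive parts.\<close>

definition partitions :: "nat \<Rightarrow> nat multiset set" where
  "partitions n = {P. sum_mset P = n \<and> 0 \<notin># P}"

lemma finite_partitions: "finite (partitions n)"
proof (rule finite_subset)
  show "partitions n \<subseteq> mset ` {xs. set xs \<subseteq> {..n} \<and> length xs \<le> n}"
  proof
    fix P assume P: "P \<in> partitions n"
    obtain xs where xs: "P = mset xs" by (metis ex_mset)
    have sum: "sum_list xs = n" and pos: "0 \<notin> set xs"
      using P by (auto simp: partitions_def xs sum_mset_sum_list)
    have "length ys \<le> sum_list ys" if "0 \<notin> set ys" for ys :: "nat list"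
      using that by (induction ys) auto
    then have "length xs \<le> n" using sum pos by blast
    moreover have "set xs \<subseteq> {..n}" using sum member_le_sum_list by fastforce
    ultimately show "P \<in> mset ` {xs. set xs \<subseteq> {..n} \<and> length xs \<le> n}" using xs by blast
  qed
qed (simp add: finite_lists_length_le)

definition num_partitions :: "nat \<Rightarrow> nat" where
  "num_partitions n = card (partitions n)"

definition num_even_partitions :: "nat \<Rightarrow> nat" where
  "num_even_partitions n = card {P \<in> partitions n. even (size P)}"

end

theory Submission
  imports Defs "HOL-Combinatorics.Orbits"
begin

text \<open>Since \<open>nat\<close> is infinite, the conjugacy class of an even permutation is determined by the
  multiset of its nontrivial cycle lengths (a conjugator can be made even by a transposition of
  fixed points). Its conjugacy length is \<open>\<Sum> \<lfloor>c / 2\<rfloor>\<close> over the cycle lengths \<open>c\<close>. For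
  the lower bound, twice this sum is the number of points minus the number of odd orbits, and one
  3-cycle changes the number of odd orbits by at most two; for the upper bound, an odd cycle of
  length \<open>2m + 1\<close> is a product of \<open>m\<close> consecutive 3-cycles and a pair of even cycles of lengths
  \<open>2a\<close>, \<open>2b\<close> is a product of \<open>a + b\<close> of them. Sending odd cycles to parts \<open>m\<close> of one partition
  and even cycles, of which there are evenly many, to parts of another gives the factorization.
  The product formula follows by counting partitions with the weight \<open>z\<^sup>s\<close>, where \<open>s\<close> is the
  number of parts and \<open>z\<close> is \<open>1\<close> or \<open>-1\<close>.\<close>

section \<open>Cycle types\<close>

text \<open>Fixed points are left out: a permutation with finite support then has only finitely many
  cycle sets, and \<open>mset_set\<close> in \<open>cycle_type\<close> is meaningful.\<close>

definition cycle_sets :: "('a \<Rightarrow> 'a) \<Rightarrow> 'a set set" where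
  "cycle_sets p = Orbits.orbit p ` {x. p x \<noteq> x}"

definition cycle_type :: "('a \<Rightarrow> 'a) \<Rightarrow> nat multiset" where
  "cycle_type p = image_mset card (mset_set (cycle_sets p))"

text \<open>Distinctness of the concatenation says at once that each list is repetition-free and
  that different lists are disjoint. Length at least 2 makes the lists correspond exactly to the
  nontrivial orbits.\<close>

definition disjoint_cycles :: "'a list list \<Rightarrow> bool" where
  "disjoint_cycles css \<longleftrightarrow> distinct (concat css) \<and> (\<forall>cs \<in> set css. 2 \<le> length cs)"

definition comp_list :: "('a \<Rightarrow> 'a) list \<Rightarrow> 'a \<Rightarrow> 'a" where
  "comp_list ps = foldr (\<circ>) ps id"

abbreviation comp_cycles :: "'a list list \<Rightarrow> 'a \<Rightarrow> 'a" where
  "comp_cycles css \<equiv> comp_list (map cycle_of_list css)"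

lemma comp_list_simps [simp]:
  "comp_list [] = id"
  "comp_list (p # ps) = p \<circ> comp_list ps"
  by (simp_all add: comp_list_def)

lemma comp_list_append [simp]: "comp_list (ps @ qs) = comp_list ps \<circ> comp_list qs"
  by (induction ps) (auto simp: comp_assoc)

lemma disjoint_cycles_Nil [simp]: "disjoint_cycles []"
  by (simp add: disjoint_cycles_def)

lemma disjoint_cycles_Cons:
  "disjoint_cycles (cs # css) \<longleftrightarrow> distinct cs \<and> 2 \<le> length cs \<and>
     set cs \<inter> set (concat css) = {} \<and> disjoint_cycles css"
  by (auto simp: disjoint_cycles_def)

lemma permutation_comp_cycles: "permutation (comp_cycles css)"
  by (induction css) (auto intro: permutation_compose permutation_of_cycle simp del: o_apply)

lemma comp_cycles_outside: "x \<notin> set (concat css) \<Longrightarrow> comp_cycles css x = x"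
  by (induction css) (auto simp: id_outside_supp)

text \<open>All other cycles fix every point of \<open>cs\<close>, hence both \<open>x\<close> and
  its image under \<open>cs\<close>.\<close>

lemma comp_cycles_inside:
  "disjoint_cycles css \<Longrightarrow> cs \<in> set css \<Longrightarrow> x \<in> set cs \<Longrightarrow> comp_cycles css x = cycle_of_list cs x"
proof (induction css)
  case (Cons ds css)
  show ?case
  proof (cases "cs = ds")
    case True
    then have "x \<notin> set (concat css)"
      using Cons.prems by (auto simp: disjoint_cycles_Cons)
    then show ?thesis
      using True comp_cycles_outside[of x css] by simp
  next
    case False
    then have cs: "cs \<in> set css" using Cons.prems by auto
    have "cycle_of_list cs x \<in> set cs"
      using Cons.prems(3) permutes_in_image[OF cycle_permutes] by metis
    then have "cycle_of_list cs x \<notin> set ds"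
      using Cons.prems(1) cs by (auto simp: disjoint_cycles_Cons)
    then show ?thesis
      using Cons.IH Cons.prems cs by (auto simp: disjoint_cycles_Cons id_outside_supp)
  qed
qed simp

text \<open>The value at a point depends only on the cycle containing it. This allows the cycles to
  be reordered freely.\<close>

lemma comp_cycles_cong_set:
  assumes "disjoint_cycles css" "disjoint_cycles dss" "set css = set dss"
  shows "comp_cycles css = comp_cycles dss"
proof
  fix x
  show "comp_cycles css x = comp_cycles dss x"
  proof (cases "x \<in> set (concat css)")
    case True
    then obtain cs where "cs \<in> set css" "x \<in> set cs" by auto
    then show ?thesis using comp_cycles_inside assms by metis
  next
    case False
    then have "x \<notin> set (concat dss)" using assms by simp
    then show ?thesis using False comp_cycles_outside by metis
  qed
qed

lemma orbit_cycle_of_list: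
  assumes "distinct cs" "x \<in> set cs"
  shows "Orbits.orbit (cycle_of_list cs) x = set cs"
proof
  show "Orbits.orbit (cycle_of_list cs) x \<subseteq> set cs"
    by (rule permutes_orbit_subset[OF cycle_permutes assms(2)])
  show "set cs \<subseteq> Orbits.orbit (cycle_of_list cs) x"
  proof
    fix y assume "y \<in> set cs"
    then obtain j where j: "j < length cs" "y = cs ! j" by (metis in_set_conv_nth)
    obtain i where i: "i < length cs" "x = cs ! i" using assms(2) by (metis in_set_conv_nth)
    \<comment> \<open>The summand \<open>length cs\<close> keeps the subtraction from truncating
      when \<open>j < i\<close>; it vanishes modulo the length.\<close>
    let ?n = "j + length cs - i"
    have "(cycle_of_list cs ^^ ?n) x = map (cycle_of_list cs ^^ ?n) cs ! i"
      using i by simp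
    also have "\<dots> = rotate ?n cs ! i" using cyclic_rotation[OF assms(1)] by metis
    also have "\<dots> = cs ! ((?n + i) mod length cs)"
      using i by (simp add: nth_rotate)
    also have "(?n + i) mod length cs = j" using i j by simp
    finally have "y = (cycle_of_list cs ^^ ?n) x" using j by simp
    then show "y \<in> Orbits.orbit (cycle_of_list cs) x"
      unfolding orbit_altdef_permutation[OF permutation_of_cycle] by blast
  qed
qed

lemma orbit_comp_cycles:
  assumes "disjoint_cycles css" "cs \<in> set css" "x \<in> set cs"
  shows "Orbits.orbit (comp_cycles css) x = set cs"
proof -
  have dist: "distinct cs" using assms by (auto simp: disjoint_cycles_def distinct_concat_iff)
  have *: "Orbits.orbit (cycle_of_list cs) x = set cs" using orbit_cycle_of_list[OF dist assms(3)] .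
  have "Orbits.orbit (comp_cycles css) x = Orbits.orbit (cycle_of_list cs) x"
    by (rule orbit_cong) (use * assms comp_cycles_inside in auto)
  then show ?thesis using * by simp
qed

lemma cycle_sets_comp_cycles:
  assumes "disjoint_cycles css"
  shows "cycle_sets (comp_cycles css) = set ` set css"
proof -
  have moved: "comp_cycles css x \<noteq> x" if "cs \<in> set css" "x \<in> set cs" for cs x
  proof
    assume "comp_cycles css x = x"
    then have "Orbits.orbit (comp_cycles css) x = {x}" by (simp add: orbit_eq_singleton_iff)
    then have "card (set cs) = 1" using orbit_comp_cycles[OF assms that] by simp
    moreover have "card (set cs) = length cs" "2 \<le> length cs"
      using assms that by (auto simp: disjoint_cycles_def distinct_card distinct_concat_iff)
    ultimately show False by simp
  qed
  show ?thesis
  proof (intro equalityI subsetI)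
    fix A assume "A \<in> cycle_sets (comp_cycles css)"
    then obtain x where x: "A = Orbits.orbit (comp_cycles css) x" "comp_cycles css x \<noteq> x"
      by (auto simp: cycle_sets_def)
    then have "x \<in> set (concat css)" using comp_cycles_outside by metis
    then obtain cs where cs: "cs \<in> set css" "x \<in> set cs" by auto
    then show "A \<in> set ` set css"
      unfolding x(1) orbit_comp_cycles[OF assms cs] by blast
  next
    fix A assume "A \<in> set ` set css"
    then obtain cs where cs: "cs \<in> set css" "A = set cs" by auto
    then have "cs \<noteq> []" using assms by (auto simp: disjoint_cycles_def)
    then obtain x where x: "x \<in> set cs" by (meson last_in_set)
    show "A \<in> cycle_sets (comp_cycles css)"
      unfolding cycle_sets_def
      using orbit_comp_cycles[OF assms cs(1) x] moved[OF cs(1) x] cs(2) by blast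
  qed
qed

text \<open>Nonempty disjoint sets are distinct, so passing from the list of cycles to the set of
  orbits loses no multiplicities of lengths.\<close>

lemma distinct_map_set_disjoint_cycles: "disjoint_cycles css \<Longrightarrow> distinct (map set css)"
proof (induction css)
  case (Cons cs css)
  have "set cs \<noteq> set ds" if "ds \<in> set css" for ds
  proof
    assume eq: "set cs = set ds"
    have "set cs \<inter> set ds = {}" using Cons.prems that by (auto simp: disjoint_cycles_Cons)
    then have "set cs = {}" using eq by simp
    then show False using Cons.prems by (auto simp: disjoint_cycles_Cons)
  qed
  then show ?case using Cons by (auto simp: disjoint_cycles_Cons)
qed simp

lemma cycle_type_comp_cycles:
  assumes "disjoint_cycles css"
  shows "cycle_type (comp_cycles css) = mset (map length css)"
proof -
  have "mset_set (cycle_sets (comp_cycles css)) = mset (map set css)"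
    using cycle_sets_comp_cycles[OF assms] mset_set_set[OF distinct_map_set_disjoint_cycles[OF assms]]
    by simp
  moreover have "map (card \<circ> set) css = map length css"
    using assms by (auto simp: disjoint_cycles_def distinct_card distinct_concat_iff)
  ultimately show ?thesis by (metis cycle_type_def map_map mset_map)
qed

lemma cycle_decomp_imp_comp_cycles:
  "cycle_decomp I p \<Longrightarrow> \<exists>css. disjoint_cycles css \<and> p = comp_cycles css \<and> set (concat css) \<subseteq> I"
proof (induction rule: cycle_decomp.induct)
  case empty
  show ?case by (rule exI[of _ "[]"]) simp
next
  case (comp I p cs)
  then obtain css where css: "disjoint_cycles css" "p = comp_cycles css" "set (concat css) \<subseteq> I"
    by blast
  show ?case
  proof (cases "2 \<le> length cs")
    case True
    then have "disjoint_cycles (cs # css)" using css comp by (auto simp: disjoint_cycles_Cons)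
    then show ?thesis using css by (intro exI[of _ "cs # css"]) auto
  next
    \<comment> \<open>A list with at most one entry denotes the identity and is dropped.\<close>
    case False
    then have "cycle_of_list cs = id" by (cases cs rule: cycle_of_list.cases) auto
    then show ?thesis using css by (intro exI[of _ css]) auto
  qed
qed

lemma permutation_obtain_cycles:
  assumes "permutation p"
  obtains css where "disjoint_cycles css" "p = comp_cycles css"
  using assms cycle_decomposition cycle_decomp_imp_comp_cycles by (metis permutation_permutes)

section \<open>Conjugacy and cycle type\<close>

lemma conj_comp_cycles:
  assumes "bij h" "disjoint_cycles css"
  shows "h \<circ> comp_cycles css \<circ> inv' h = comp_cycles (map (map h) css)"
  using assms(2)
proof (induction css)
  case Nil
  then show ?case using surj_iff[of h] assms(1) by (simp add: bij_is_surj)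
next
  case (Cons cs css)
  have inv: "inv' h \<circ> h = id" using assms(1) by (simp add: bij_is_inj)
  have "h \<circ> comp_cycles (cs # css) \<circ> inv' h
      = (h \<circ> cycle_of_list cs \<circ> inv' h) \<circ> (h \<circ> comp_cycles css \<circ> inv' h)"
    using inv by (simp add: fun_eq_iff)
  also have "\<dots> = comp_cycles (map (map h) (cs # css))"
  proof -
    have "h \<circ> cycle_of_list cs \<circ> inv' h = cycle_of_list (map h cs)"
      using Cons.prems conjugation_of_cycle[OF _ assms(1)] by (simp add: disjoint_cycles_Cons)
    moreover have "h \<circ> comp_cycles css \<circ> inv' h = comp_cycles (map (map h) css)"
      using Cons.IH Cons.prems by (simp only: disjoint_cycles_Cons)
    ultimately show ?thesis by (simp only: list.map comp_list_simps)
  qed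
  finally show ?case .
qed

lemma disjoint_cycles_map:
  "inj h \<Longrightarrow> disjoint_cycles css \<Longrightarrow> disjoint_cycles (map (map h) css)"
  by (auto simp: disjoint_cycles_def distinct_map map_concat[symmetric] intro: inj_on_subset)

lemma cycle_type_conj:
  assumes "bij h" "permutation p"
  shows "cycle_type (h \<circ> p \<circ> inv' h) = cycle_type p"
proof -
  obtain css where css: "disjoint_cycles css" "p = comp_cycles css"
    using permutation_obtain_cycles[OF assms(2)] .
  have "map length (map (map h) css) = map length css" by (simp add: comp_def)
  then show ?thesis
    using css conj_comp_cycles[OF assms(1) css(1)]
      cycle_type_comp_cycles[OF disjoint_cycles_map[OF bij_is_inj[OF assms(1)] css(1)]]
      cycle_type_comp_cycles[OF css(1)] by (simp only:)
qed

text \<open>A permutation that is right on the tail is corrected at the head by swapping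
  \<open>h x\<close> with \<open>y\<close>. Neither of these is a value on the tail, by injectivity
  and by distinctness of the targets.\<close>

lemma permutation_map_list:
  "distinct xs \<Longrightarrow> distinct ys \<Longrightarrow> length xs = length ys \<Longrightarrow> \<exists>h. permutation h \<and> map h xs = ys"
proof (induction xs arbitrary: ys)
  case Nil
  then show ?case using permutation_id by auto
next
  case (Cons x xs ys')
  then obtain y ys where ys': "ys' = y # ys" by (cases ys') auto
  with Cons obtain h where h: "permutation h" "map h xs = ys" by fastforce
  have inj: "inj h" using h(1) permutation_bijective bij_is_inj by blast
  let ?h = "Transposition.transpose (h x) y \<circ> h"
  have "?h z = h z" if "z \<in> set xs" for z
  proof -
    have "h z \<noteq> h x" using inj that Cons.prems(1) by (auto simp: inj_eq)
    moreover have "h z \<noteq> y" using that h(2) Cons.prems(2) ys' by auto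
    ultimately show ?thesis by simp
  qed
  then have "map ?h (x # xs) = ys'" using h(2) ys' by auto
  moreover have "permutation ?h" using h(1) by (intro permutation_compose permutation_swap_id)
  ultimately show ?case by blast
qed

text \<open>An odd solution is made even by first swapping two points outside \<open>xs\<close>,
  which exist because the type is infinite.\<close>

lemma even_permutation_map_list:
  assumes "distinct xs" "distinct ys" "length xs = length ys" "infinite (UNIV :: 'a set)"
  shows "\<exists>h :: 'a \<Rightarrow> 'a. permutation h \<and> evenperm h \<and> map h xs = ys"
proof -
  obtain h where h: "permutation h" "map h xs = ys"
    using permutation_map_list assms by blast
  show ?thesis
  proof (cases "evenperm h")
    case True
    then show ?thesis using h by blast
  next
    case False
    obtain a where a: "a \<notin> set xs"
      using assms(4) ex_new_if_finite[OF _ finite_set] by blast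
    obtain b where b: "b \<notin> insert a (set xs)"
      using assms(4) ex_new_if_finite[of "insert a (set xs)"] by blast
    let ?h = "h \<circ> Transposition.transpose a b"
    have "map ?h xs = ys"
      using a b h(2) by (auto simp: Transposition.transpose_def)
    moreover have "permutation ?h" using h(1) by (intro permutation_compose permutation_swap_id)
    moreover have "evenperm ?h"
      using False h(1) b by (auto simp add: evenperm_comp permutation_swap_id evenperm_swap)
    ultimately show ?thesis by blast
  qed
qed

text \<open>The cycles of \<open>q\<close> are listed so that their lengths match those of
  \<open>p\<close> one by one. An even permutation taking one concatenated list to the other then
  conjugates \<open>p\<close> into \<open>q\<close>.\<close>

lemma conj_if_cycle_type_eq:
  fixes p q :: "'a \<Rightarrow> 'a"
  assumes "permutation p" "permutation q" "cycle_type p = cycle_type q" "infinite (UNIV :: 'a set)"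
  shows "\<exists>h. permutation h \<and> evenperm h \<and> q = h \<circ> p \<circ> inv' h"
proof -
  obtain css where css: "disjoint_cycles css" "p = comp_cycles css"
    using permutation_obtain_cycles[OF assms(1)] .
  obtain dss where dss: "disjoint_cycles dss" "q = comp_cycles dss"
    using permutation_obtain_cycles[OF assms(2)] .
  have "mset (map length css) = mset (map length dss)"
    using assms(3) css dss cycle_type_comp_cycles by metis
  then obtain f where f: "f permutes {..<length (map length dss)}"
    "permute_list f (map length dss) = map length css"
    using mset_eq_permutation by blast
  define ess where "ess = permute_list f dss"
  have len: "map length ess = map length css"
    using f permute_list_map[of f dss length] by (simp add: ess_def)
  have mset: "mset ess = mset dss" using f by (simp add: ess_def)
  then have set: "set ess = set dss" using mset_eq_setD by blast
  have "mset (concat xss) = sum_mset (image_mset mset (mset xss))" for xss :: "'a list list"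
    by (induction xss) auto
  then have "mset (concat ess) = mset (concat dss)" using mset by simp
  then have "distinct (concat ess) \<longleftrightarrow> distinct (concat dss)" by (rule mset_eq_imp_distinct_iff)
  then have ess: "disjoint_cycles ess" using dss(1) set by (simp add: disjoint_cycles_def)
  have q: "q = comp_cycles ess" using comp_cycles_cong_set[OF ess dss(1) set] dss(2) by simp
  have "length (concat css) = length (concat ess)" using len by (simp add: length_concat)
  then obtain h where h: "permutation h" "evenperm h" "map h (concat css) = concat ess"
    using even_permutation_map_list[OF _ _ _ assms(4), of "concat css" "concat ess"] css(1) ess
    unfolding disjoint_cycles_def by blast
  \<comment> \<open>Equal concatenations with the same block lengths have the same blocks.\<close>
  have "map (map h) css = ess"
  proof (rule concat_injective)
    show "concat (map (map h) css) = concat ess" using h(3) by (simp add: map_concat)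
    show l: "length (map (map h) css) = length ess" using len by (metis length_map)
    show "\<forall>(x, y)\<in>set (zip (map (map h) css) ess). length x = length y"
    proof safe
      fix x y assume "(x, y) \<in> set (zip (map (map h) css) ess)"
      then obtain i where "i < length ess" "x = map h (css ! i)" "y = ess ! i"
        using l by (auto simp: set_zip)
      then show "length x = length y" using len l by (metis length_map nth_map)
    qed
  qed
  then have "q = h \<circ> p \<circ> inv' h"
    using conj_comp_cycles[OF permutation_bijective[OF h(1)] css(1)] css(2) q by simp
  then show ?thesis using h by blast
qed

section \<open>Parity in terms of cycle type\<close>

lemma evenperm_cycle_of_list:
  "distinct cs \<Longrightarrow> cs \<noteq> [] \<Longrightarrow> evenperm (cycle_of_list cs) \<longleftrightarrow> odd (length cs)"
proof (induction cs rule: cycle_of_list.induct)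
  case (1 i j cs)
  then show ?case
    unfolding cycle_of_list.simps evenperm_comp[OF permutation_swap_id permutation_of_cycle] evenperm_swap
    by simp
qed auto

text \<open>Exactly the cycles of even length are odd permutations, and signs multiply.\<close>

lemma evenperm_comp_cycles:
  "disjoint_cycles css \<Longrightarrow>
    evenperm (comp_cycles css) \<longleftrightarrow> even (size (filter_mset even (mset (map length css))))"
proof (induction css)
  case (Cons cs css)
  then have "cs \<noteq> []" by (auto simp: disjoint_cycles_Cons)
  then show ?case
    using Cons by (auto simp: disjoint_cycles_Cons evenperm_comp permutation_of_cycle
        permutation_comp_cycles evenperm_cycle_of_list simp del: o_apply)
qed simp

lemma evenperm_iff_cycle_type:
  assumes "permutation p"
  shows "evenperm p \<longleftrightarrow> even (size (filter_mset even (cycle_type p)))"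
proof -
  obtain css where "disjoint_cycles css" "p = comp_cycles css"
    using permutation_obtain_cycles[OF assms] .
  then show ?thesis using evenperm_comp_cycles cycle_type_comp_cycles by metis
qed

lemma cycle_type_ge_2:
  assumes "permutation p" "c \<in># cycle_type p"
  shows "2 \<le> c"
proof -
  obtain css where "disjoint_cycles css" "p = comp_cycles css"
    using permutation_obtain_cycles[OF assms(1)] .
  then show ?thesis
    using assms(2) cycle_type_comp_cycles[of css] by (auto simp: disjoint_cycles_def)
qed

section \<open>Words in 3-cycles\<close>

text \<open>This turns out to be the conjugacy length of an even permutation of cycle type
  \<open>M\<close>. A cycle of length 1 would contribute 0, which agrees with fixed points being
  absent from cycle types.\<close>

definition weight :: "nat multiset \<Rightarrow> nat" where
  "weight M = (\<Sum>c\<in>#M. c div 2)"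

text \<open>Fixed points count as odd orbits here, so the count is taken inside a set
  \<open>W\<close>, finite in all uses.\<close>

definition odd_orbits :: "('a \<Rightarrow> 'a) \<Rightarrow> 'a set \<Rightarrow> 'a set set" where
  "odd_orbits p W = {A \<in> Orbits.orbit p ` W. odd (card A)}"

lemma sum_card_orbits:
  assumes "p permutes W" "finite W"
  shows "(\<Sum>A\<in>Orbits.orbit p ` W. card A) = card W"
proof -
  have p: "permutation p" using assms permutation_permutes by blast
  have "pairwise disjnt (Orbits.orbit p ` W)"
  proof (rule pairwiseI, rule ccontr)
    fix A B assume A: "A \<in> Orbits.orbit p ` W" "B \<in> Orbits.orbit p ` W" "A \<noteq> B" "\<not> disjnt A B"
    then obtain z where z: "z \<in> A" "z \<in> B" by (auto simp: disjnt_def)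
    have "cyclic_on p A" "cyclic_on p B" using A cyclic_on_orbit'[OF p] by auto
    then show False using orbit_cyclic_eq3 z A(3) by metis
  qed
  moreover have "finite A" if "A \<in> Orbits.orbit p ` W" for A
    using that cyclic_on_orbit'[OF p] finite_cyclic_on by auto
  moreover have "\<Union> (Orbits.orbit p ` W) = W"
    using permutes_orbit_subset[OF assms(1)] permutation_self_in_orbit[OF p] by blast
  ultimately show ?thesis using card_Union_disjoint by metis
qed

text \<open>Each orbit \<open>A\<close> satisfies
  \<open>card A = 2 * (card A div 2) + card A mod 2\<close>; summing over the orbits, which
  partition \<open>W\<close>, gives the claim.\<close>

lemma weight_cycle_type:
  assumes "p permutes W" "finite W"
  shows "2 * weight (cycle_type p) + card (odd_orbits p W) = card W"
proof -
  let ?O = "Orbits.orbit p ` W"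
  have fin: "finite ?O" using assms by simp
  have sub: "cycle_sets p \<subseteq> ?O"
    using permutes_not_in[OF assms(1)] by (auto simp: cycle_sets_def)
  have "weight (cycle_type p) = (\<Sum>A\<in>cycle_sets p. card A div 2)"
    by (simp add: weight_def cycle_type_def image_mset.compositionality comp_def sum_unfold_sum_mset)
  also have "\<dots> = (\<Sum>A\<in>?O. card A div 2)"
  \<comment> \<open>The additional orbits are fixed points and contribute
    \<open>1 div 2 = 0\<close>.\<close>
  proof (rule sum.mono_neutral_left[OF fin sub], rule ballI)
    fix A assume "A \<in> ?O - cycle_sets p"
    then obtain x where "A = Orbits.orbit p x" "p x = x" by (auto simp: cycle_sets_def)
    then have "A = {x}" by (simp add: orbit_eq_singleton_iff)
    then show "card A div 2 = 0" by simp
  qed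
  finally have w: "weight (cycle_type p) = (\<Sum>A\<in>?O. card A div 2)" .
  have "card (odd_orbits p W) = (\<Sum>A\<in>?O. card A mod 2)"
  proof -
    have "(\<Sum>A\<in>?O. card A mod 2) = (\<Sum>A\<in>?O. if odd (card A) then 1 else 0)"
      by (intro sum.cong) (auto simp: odd_iff_mod_2_eq_one)
    also have "\<dots> = card {A \<in> ?O. odd (card A)}"
      using fin by (simp add: sum.If_cases Int_def)
    finally show ?thesis by (simp add: odd_orbits_def)
  qed
  then have "2 * weight (cycle_type p) + card (odd_orbits p W) = (\<Sum>A\<in>?O. 2 * (card A div 2) + card A mod 2)"
    by (simp only: w sum.distrib sum_distrib_left)
  also have "\<dots> = card W" using sum_card_orbits[OF assms] by (simp only: mult_div_mod_eq)
  finally show ?thesis .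
qed

text \<open>An orbit of \<open>p\<close> avoiding the three points moved by \<open>t\<close> is also an orbit of \<open>t \<circ> p\<close>, so at most
  three odd orbits are lost; as the number of odd orbits in \<open>W\<close> has the parity of \<open>card W\<close>,
  at most two are.\<close>

lemma weight_three_cycle_comp:
  assumes "permutation p" "distinct ts" "length ts = 3"
  shows "weight (cycle_type (cycle_of_list ts \<circ> p)) \<le> weight (cycle_type p) + 1"
proof -
  let ?t = "cycle_of_list ts"
  obtain V where V: "finite V" "p permutes V" using assms(1) permutation_permutes by blast
  \<comment> \<open>Both permutations must act on one common finite set for their odd orbits to be
    compared.\<close>
  define W where "W = V \<union> set ts"
  have W: "finite W" "p permutes W" "?t permutes W"
    using V permutes_subset[OF V(2)] permutes_subset[OF cycle_permutes, of ts W] by (auto simp: W_def)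
  have tp: "(?t \<circ> p) permutes W" using W(2,3) by (rule permutes_compose)
  have "odd_orbits p W \<subseteq> odd_orbits (?t \<circ> p) W \<union> Orbits.orbit p ` set ts"
  proof
    fix A assume A: "A \<in> odd_orbits p W"
    then obtain w where w: "w \<in> W" "A = Orbits.orbit p w" by (auto simp: odd_orbits_def)
    show "A \<in> odd_orbits (?t \<circ> p) W \<union> Orbits.orbit p ` set ts"
    proof (cases "A \<inter> set ts = {}")
      case True
      have "Orbits.orbit (?t \<circ> p) w = Orbits.orbit p w"
      proof (rule orbit_cong[OF permutation_self_in_orbit[OF assms(1)]])
        fix s assume "s \<in> Orbits.orbit p w"
        then have "p s \<notin> set ts" using True w(2) orbit.step[of s p w] by auto
        then show "(?t \<circ> p) s = p s" by (simp add: id_outside_supp)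
      qed
      then show ?thesis using A w by (auto simp: odd_orbits_def)
    next
      case False
      then obtain x where "x \<in> A" "x \<in> set ts" by auto
      then show ?thesis
        using orbit_cyclic_eq3[OF cyclic_on_orbit'[OF assms(1)]] w(2) by blast
    qed
  qed
  then have "card (odd_orbits p W) \<le> card (odd_orbits (?t \<circ> p) W \<union> Orbits.orbit p ` set ts)"
    using W(1) by (intro card_mono) (auto simp: odd_orbits_def)
  also have "\<dots> \<le> card (odd_orbits (?t \<circ> p) W) + card (Orbits.orbit p ` set ts)"
    by (rule card_Un_le)
  also have "card (Orbits.orbit p ` set ts) \<le> 3"
    using card_image_le[of "set ts" "Orbits.orbit p"] assms(2,3) by (simp add: distinct_card)
  finally have "card (odd_orbits p W) \<le> card (odd_orbits (?t \<circ> p) W) + 3" by linarith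
  then show ?thesis
    using weight_cycle_type[OF W(2,1)] weight_cycle_type[OF tp W(1)] by presburger
qed

text \<open>The identity has weight 0, and each further 3-cycle raises the weight by at most
  one.\<close>

lemma weight_cycle_type_le_length:
  assumes "set ts \<subseteq> {cycle_of_list cs | cs. distinct cs \<and> length cs = 3}"
  shows "weight (cycle_type (comp_list ts :: 'a \<Rightarrow> 'a)) \<le> length ts"
proof -
  have "permutation (comp_list ts) \<and> weight (cycle_type (comp_list ts)) \<le> length ts"
    using assms
  proof (induction ts)
    case Nil
    have "weight (cycle_type (id :: 'a \<Rightarrow> 'a)) = 0"
      by (simp add: cycle_type_def cycle_sets_def weight_def)
    then show ?case by (simp only: comp_list_simps permutation_id le0 simp_thms)
  next
    case (Cons t ts)
    then obtain cs where cs: "t = cycle_of_list cs" "distinct cs" "length cs = 3" by auto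
    have IH: "permutation (comp_list ts)" "weight (cycle_type (comp_list ts)) \<le> length ts"
      using Cons by auto
    have "permutation (t \<circ> comp_list ts)"
      unfolding cs(1) by (rule permutation_compose[OF permutation_of_cycle IH(1)])
    moreover have "weight (cycle_type (t \<circ> comp_list ts)) \<le> Suc (length ts)"
      using weight_three_cycle_comp[OF IH(1) cs(2,3)] IH(2) cs(1) by simp
    ultimately show ?case by (simp only: comp_list_simps list.size add_0_right add_Suc_right simp_thms)
  qed
  then show ?thesis ..
qed

section \<open>Short words for odd cycles and for pairs of even cycles\<close>

lemma cycle_of_list_append:
  "cycle_of_list (xs @ y # zs) = cycle_of_list (xs @ [y]) \<circ> cycle_of_list (y # zs)"
\<comment> \<open>As a product of transpositions of neighbouring entries, a cycle can be cut at any
  entry, which then belongs to both factors.\<close>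
proof (induction xs)
  case (Cons x xs)
  then show ?case by (cases xs) (simp_all add: comp_assoc)
qed simp

definition triples :: "nat \<Rightarrow> nat \<Rightarrow> (nat \<Rightarrow> nat) list" where
  "triples k n = map (\<lambda>i. cycle_of_list [k + 2 * i, k + 2 * i + 1, k + 2 * i + 2]) [0..<n]"

lemma length_triples [simp]: "length (triples k n) = n"
  by (simp add: triples_def)

lemma set_triples: "set (triples k n) \<subseteq> S_Alt_N"
  by (auto simp: triples_def S_Alt_N_def simp del: cycle_of_list.simps)

text \<open>Consecutive letters share one point, so \<open>cycle_of_list_append\<close> fuses them
  into a single cycle of odd length \<open>2 * n + 1\<close>.\<close>

lemma comp_list_triples: "comp_list (triples k n) = cycle_of_list [k..<k + 2 * n + 1]"
proof (induction n)
  case 0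
  then show ?case by (simp add: triples_def)
next
  case (Suc n)
  let ?m = "k + 2 * n"
  have "comp_list (triples k (Suc n)) = comp_list (triples k n) \<circ> cycle_of_list [?m, ?m + 1, ?m + 2]"
    by (simp add: triples_def del: cycle_of_list.simps)
  also have "\<dots> = cycle_of_list ([k..<?m] @ [?m]) \<circ> cycle_of_list (?m # [?m + 1, ?m + 2])"
    unfolding Suc by simp
  also have "\<dots> = cycle_of_list ([k..<?m] @ ?m # [?m + 1, ?m + 2])"
    by (rule cycle_of_list_append[symmetric])
  also have "[k..<?m] @ ?m # [?m + 1, ?m + 2] = [k..<k + 2 * Suc n + 1]"
  proof -
    have "k + 2 * Suc n + 1 = Suc (Suc (Suc ?m))" by simp
    then show ?thesis by simp
  qed
  finally show ?case .
qed

text \<open>Written in transpositions of neighbours, the left side is (x, x+1) (x+1, x+2) (x+1, x+2)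
  (x+2, x+3), and the middle pair cancels.\<close>

lemma three_cycle_comp_three_cycle:
  fixes x :: nat
  shows "cycle_of_list [x, x + 1, x + 2] \<circ> cycle_of_list [x + 1, x + 2, x + 3] =
    cycle_of_list [x, x + 1] \<circ> cycle_of_list [x + 2, x + 3]"
  by (auto simp: fun_eq_iff Transposition.transpose_def)

text \<open>The word \<open>(k, k+1, k+2) \<dots> (m, m+1, m+2) (m+1, m+2, m+3) (m+3, m+4, m+5) \<dots>\<close> with
  \<open>m = k + 2a\<close>, whose two middle letters compose to \<open>(m, m+1) (m+2, m+3)\<close>, produces two
  adjacent even cycles.\<close>

lemma even_cycle_pair_word:
  "comp_list (triples k a @ cycle_of_list [k + 2 * a, k + 2 * a + 1, k + 2 * a + 2] #
      triples (k + 2 * a + 1) 1 @ triples (k + 2 * a + 3) b) =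
    cycle_of_list [k..<k + 2 * a + 2] \<circ> cycle_of_list [k + 2 * a + 2..<k + 2 * a + 2 * b + 4]"
proof -
  let ?m = "k + 2 * a"
  have upt: "[?m + 3..<?m + 3 + 2 * b + 1] = (?m + 3) # [?m + 4..<?m + 2 * b + 4]"
    "[?m + 2..<?m + 2 * b + 4] = (?m + 2) # (?m + 3) # [?m + 4..<?m + 2 * b + 4]"
    using upt_conv_Cons[of "?m + 3" "?m + 2 * b + 4"] upt_conv_Cons[of "?m + 2" "?m + 2 * b + 4"]
    by (simp_all add: eval_nat_numeral del: upt_Suc)
  have e1: "comp_list (triples k a) = cycle_of_list ([k..<?m] @ [?m])"
    by (simp add: comp_list_triples)
  have e2: "comp_list (triples (?m + 3) b) = cycle_of_list ((?m + 3) # [?m + 4..<?m + 2 * b + 4])"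
    by (simp only: comp_list_triples upt)
  have "comp_list (triples k a @ cycle_of_list [?m, ?m + 1, ?m + 2] #
      triples (?m + 1) 1 @ triples (?m + 3) b)
    = comp_list (triples k a) \<circ> (cycle_of_list [?m, ?m + 1, ?m + 2] \<circ> cycle_of_list [?m + 1, ?m + 2, ?m + 3])
      \<circ> comp_list (triples (?m + 3) b)"
    by (simp add: triples_def comp_assoc numeral_3_eq_3 del: cycle_of_list.simps)
  \<comment> \<open>Each of the two transpositions shares a point with one neighbouring odd cycle
    and lengthens it by one entry.\<close>
  also have "\<dots> = (cycle_of_list ([k..<?m] @ [?m]) \<circ> cycle_of_list (?m # [?m + 1])) \<circ>
     (cycle_of_list ([?m + 2] @ [?m + 3]) \<circ> cycle_of_list ((?m + 3) # [?m + 4..<?m + 2 * b + 4]))"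
    by (simp only: e1 e2 three_cycle_comp_three_cycle comp_assoc append.simps)
  also have "\<dots> = cycle_of_list ([k..<?m] @ ?m # [?m + 1]) \<circ>
     cycle_of_list ([?m + 2] @ (?m + 3) # [?m + 4..<?m + 2 * b + 4])"
    by (simp only: cycle_of_list_append[of "[k..<?m]" ?m "[?m + 1]"]
        cycle_of_list_append[of "[?m + 2]" "?m + 3" "[?m + 4..<?m + 2 * b + 4]"])
  also have "[k..<?m] @ ?m # [?m + 1] = [k..<?m + 2]" by simp
  also have "[?m + 2] @ (?m + 3) # [?m + 4..<?m + 2 * b + 4] = [?m + 2..<?m + 2 * b + 4]"
    using upt(2) by simp
  finally show ?thesis .
qed

section \<open>Signed partition counts\<close>

text \<open>The coefficient of \<open>q^n\<close> in the product of \<open>1 / (1 - z * q^j)\<close>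
  over \<open>1 \<le> j \<le> k\<close>. At \<open>z = 1\<close> it counts partitions; at
  \<open>z = -1\<close> it counts those with evenly many parts minus the others.\<close>

definition signed_partitions :: "rat \<Rightarrow> nat \<Rightarrow> nat \<Rightarrow> rat" where
  "signed_partitions z k n = (\<Sum>P | P \<in> partitions n \<and> set_mset P \<subseteq> {..k}. z ^ size P)"

lemma partition_part_le: "P \<in> partitions n \<Longrightarrow> set_mset P \<subseteq> {..n}"
  by (auto simp: partitions_def sum_mset.remove)

lemma signed_partitions_0: "signed_partitions z 0 n = (if n = 0 then 1 else 0)"
proof -
  have "P = {#}" if "P \<in> partitions n" "set_mset P \<subseteq> {..0}" for P
  proof -
    have "set_mset P = {}" using that by (auto simp: partitions_def)
    then show ?thesis by simp
  qed
  moreover have "{#} \<in> partitions n \<longleftrightarrow> n = 0" by (auto simp: partitions_def)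
  ultimately have "{P. P \<in> partitions n \<and> set_mset P \<subseteq> {..0}} = (if n = 0 then {{#}} else {})"
    by auto
  then show ?thesis by (simp add: signed_partitions_def)
qed

text \<open>A partition either avoids the part \<open>Suc k\<close> or loses one copy of it. In the
  second case further copies may remain, so the bound stays \<open>Suc k\<close>, and
  \<open>z\<close> accounts for the lost part.\<close>

lemma signed_partitions_Suc:
  "signed_partitions z (Suc k) n = signed_partitions z k n +
     (if Suc k \<le> n then z * signed_partitions z (Suc k) (n - Suc k) else 0)"
proof -
  let ?A = "{P. P \<in> partitions n \<and> set_mset P \<subseteq> {..k}}"
  let ?B = "{P. P \<in> partitions n \<and> set_mset P \<subseteq> {..Suc k} \<and> Suc k \<in># P}"
  let ?C = "{P. P \<in> partitions (n - Suc k) \<and> set_mset P \<subseteq> {..Suc k}}"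
  have "{P. P \<in> partitions n \<and> set_mset P \<subseteq> {..Suc k}} = ?A \<union> ?B"
    by (auto simp: atMost_Suc subset_insert)
  moreover have "?A \<inter> ?B = {}" by auto
  moreover have "finite ?A" "finite ?B"
    using finite_partitions[of n] by auto
  ultimately have "signed_partitions z (Suc k) n = signed_partitions z k n + (\<Sum>P\<in>?B. z ^ size P)"
    by (simp add: signed_partitions_def sum.union_disjoint)
  also have "(\<Sum>P\<in>?B. z ^ size P) =
    (if Suc k \<le> n then z * signed_partitions z (Suc k) (n - Suc k) else 0)"
  proof (cases "Suc k \<le> n")
    case True
    have "?B = add_mset (Suc k) ` ?C"
    proof (intro equalityI subsetI)
      fix P assume P: "P \<in> ?B"
      then obtain Q where "P = add_mset (Suc k) Q" by (auto dest: multi_member_split)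
      then show "P \<in> add_mset (Suc k) ` ?C" using P by (auto simp: partitions_def)
    qed (use True in \<open>auto simp: partitions_def\<close>)
    then have "(\<Sum>P\<in>?B. z ^ size P) = (\<Sum>P\<in>?C. z ^ size (add_mset (Suc k) P))"
      by (simp add: sum.reindex inj_on_def)
    then show ?thesis using True by (simp add: signed_partitions_def sum_distrib_left)
  next
    case False
    then have "?B = {}" using partition_part_le by fastforce
    then show ?thesis using False by (simp only: sum.empty if_False)
  qed
  finally show ?thesis .
qed

text \<open>No part of a partition of \<open>n\<close> exceeds \<open>n\<close>. The coefficients of
  the finite products therefore stabilise, which gives convergence of the infinite product.\<close>

lemma signed_partitions_eq: "n \<le> k \<Longrightarrow> signed_partitions z k n = signed_partitions z n n"
  using partition_part_le by (fastforce simp: signed_partitions_def intro!: sum.cong)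

section \<open>Product formulas for the generating functions\<close>

definition partition_series :: "rat \<Rightarrow> rat fps" where
  "partition_series z = Abs_fps (\<lambda>n. signed_partitions z n n)"

text \<open>By the recurrence, multiplying the series for \<open>Suc k\<close> by
  \<open>1 - z * X^(Suc k)\<close> yields the series for \<open>k\<close>.\<close>

lemma prod_partition_series:
  "(\<Prod>j<k. inverse (1 - fps_const z * fps_X ^ Suc j)) = Abs_fps (signed_partitions z k)"
proof (induction k)
  case 0
  show ?case by (rule fps_ext) (simp add: signed_partitions_0)
next
  case (Suc k)
  let ?D = "1 - fps_const z * fps_X ^ Suc k :: rat fps"
  have nz: "fps_nth ?D 0 \<noteq> 0" by simp
  have "Abs_fps (signed_partitions z k) = Abs_fps (signed_partitions z (Suc k)) * ?D"
  proof (rule fps_ext)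
    fix n
    have "Abs_fps (signed_partitions z (Suc k)) * ?D =
      Abs_fps (signed_partitions z (Suc k)) -
        fps_const z * (fps_X ^ Suc k * Abs_fps (signed_partitions z (Suc k)))"
      by (simp add: algebra_simps)
    then show "fps_nth (Abs_fps (signed_partitions z k)) n = fps_nth (Abs_fps (signed_partitions z (Suc k)) * ?D) n"
      using signed_partitions_Suc[of z k n]
      by (simp add: fps_X_power_mult_nth del: power_Suc)
  qed
  then have "Abs_fps (signed_partitions z k) * inverse ?D = Abs_fps (signed_partitions z (Suc k))"
    using inverse_mult_eq_1'[OF nz] by (simp add: mult.assoc del: power_Suc)
  then show ?case using Suc by (simp del: power_Suc)
qed

text \<open>Two parameters are treated together because the products needed are those for
  \<open>z = w = 1\<close> and for \<open>z = 1\<close>, \<open>w = -1\<close>. Each coefficient of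
  the partial products is eventually constant.\<close>

lemma prod_partition_series_mult:
  "(\<Prod>j. inverse (1 - fps_const z * fps_X ^ Suc j) * inverse (1 - fps_const w * fps_X ^ Suc j)) =
    partition_series z * partition_series w" (is "(\<Prod>j. ?f j) = ?P")
  "convergent_prod (\<lambda>j. inverse (1 - fps_const z * fps_X ^ Suc j) *
    inverse (1 - fps_const w * fps_X ^ Suc j))"
proof -
  have "(\<lambda>n. \<Prod>j\<le>n. ?f j) \<longlonglongrightarrow> ?P"
  proof (rule tendsto_fpsI)
    fix n
    have "fps_nth (\<Prod>j\<le>m. ?f j) n = fps_nth ?P n" if "n \<le> m" for m
    proof -
      have prod: "(\<Prod>j\<le>m. ?f j) = Abs_fps (signed_partitions z (Suc m)) * Abs_fps (signed_partitions w (Suc m))"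
        by (simp only: prod.distrib lessThan_Suc_atMost[symmetric] prod_partition_series)
      show ?thesis
        unfolding prod fps_mult_nth
        by (intro sum.cong) (use that in \<open>auto simp: partition_series_def signed_partitions_eq[of _ "Suc m"]\<close>)
    qed
    then show "eventually (\<lambda>m. fps_nth (\<Prod>j\<le>m. ?f j) n = fps_nth ?P n) sequentially"
      by (auto simp: eventually_sequentially)
  qed
  \<comment> \<open>Convergence of an infinite product includes a nonzero limit; the constant
    coefficient provides it.\<close>
  moreover have "fps_nth (partition_series c) 0 \<noteq> 0" for c
    by (simp add: partition_series_def signed_partitions_0)
  then have "?P \<noteq> 0" by (metis fps_zero_nth mult_eq_0_iff)
  ultimately have "raw_has_prod ?f 0 ?P" by (simp add: raw_has_prod_def)
  then show "convergent_prod ?f" and "prodinf ?f = ?P"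
    by (auto simp: convergent_prod_def has_prod_def intro!: has_prod_unique[symmetric])
qed

lemma fps_inverse_square:
  "1 / (1 - fps_X ^ Suc j) ^ 2 =
    inverse (1 - fps_const 1 * fps_X ^ Suc j) * inverse (1 - fps_const 1 * fps_X ^ Suc j :: rat fps)"
  by (simp add: fps_divide_unit power2_eq_square fps_inverse_mult del: power_Suc)

lemma fps_inverse_difference_of_squares:
  "1 / (1 - fps_X ^ (2 * Suc j)) =
    inverse (1 - fps_const 1 * fps_X ^ Suc j) * inverse (1 - fps_const (- 1) * fps_X ^ Suc j :: rat fps)"
proof -
  have "(1 - fps_X ^ (2 * Suc j) :: rat fps) =
    (1 - fps_const 1 * fps_X ^ Suc j) * (1 - fps_const (- 1) * fps_X ^ Suc j)"
    unfolding power_even_eq fps_const_neg[symmetric] by (simp add: algebra_simps power2_eq_square del: power_Suc)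
  then show ?thesis by (simp add: fps_divide_unit fps_inverse_mult del: power_Suc)
qed

lemma num_partitions_eq: "of_nat (num_partitions n) = signed_partitions 1 n n"
proof -
  have "{P. P \<in> partitions n \<and> set_mset P \<subseteq> {..n}} = partitions n"
    using partition_part_le by auto
  then show ?thesis by (simp add: num_partitions_def signed_partitions_def)
qed

text \<open>Half of \<open>1 + (- 1) ^ s\<close> is the indicator of even \<open>s\<close>.\<close>

lemma num_even_partitions_eq:
  "of_nat (num_even_partitions n) = 1 / 2 * (signed_partitions 1 n n + signed_partitions (- 1) n n)"
proof -
  have set: "{P. P \<in> partitions n \<and> set_mset P \<subseteq> {..n}} = partitions n"
    using partition_part_le by auto
  have "of_nat (num_even_partitions n) = (\<Sum>P\<in>partitions n. if even (size P) then 1 else 0 :: rat)"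
    using finite_partitions[of n] by (simp add: num_even_partitions_def sum.If_cases Int_def)
  also have "\<dots> = (\<Sum>P\<in>partitions n. 1 / 2 * (1 ^ size P + (- 1) ^ size P))"
    by (intro sum.cong) auto
  finally show ?thesis
    unfolding signed_partitions_def set by (simp only: sum.distrib sum_distrib_left[symmetric])
qed

lemma partition_series_identity:
  "Abs_fps (\<lambda>u. of_nat (num_partitions u)) * Abs_fps (\<lambda>v. of_nat (num_even_partitions v)) =
    fps_const (1 / 2) * (\<Prod>j. 1 / (1 - fps_X ^ Suc j) ^ 2) +
    fps_const (1 / 2) * (\<Prod>j. 1 / (1 - fps_X ^ (2 * Suc j)) :: rat fps)"
proof -
  have "Abs_fps (\<lambda>u. of_nat (num_partitions u)) = partition_series 1"
    by (simp add: partition_series_def num_partitions_eq)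
  moreover have "Abs_fps (\<lambda>v. of_nat (num_even_partitions v)) =
    fps_const (1 / 2) * (partition_series 1 + partition_series (- 1))"
    by (rule fps_ext) (simp add: partition_series_def num_even_partitions_eq)
  ultimately show ?thesis
    unfolding fps_inverse_square fps_inverse_difference_of_squares prod_partition_series_mult
    by (simp add: algebra_simps)
qed

lemma partition_series_product_coeffs:
  "map (fps_nth (Abs_fps (\<lambda>u. of_nat (num_partitions u)) *
      Abs_fps (\<lambda>v. of_nat (num_even_partitions v) :: rat))) [0..<11] =
    [1, 1, 3, 5, 11, 18, 34, 55, 95, 150, 244]"
proof -
  have p: "map (\<lambda>n. signed_partitions 1 n n) [0..<11] = [1, 1, 2, 3, 5, 7, 11, 15, 22, 30, 42]"
    by (simp add: upt_rec numeral_eq_Suc signed_partitions_0 signed_partitions_Suc)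
  have m: "map (\<lambda>n. signed_partitions (- 1) n n) [0..<11] = [1, - 1, 0, - 1, 1, - 1, 1, - 1, 2, - 2, 2]"
    by (simp add: upt_rec numeral_eq_Suc signed_partitions_0 signed_partitions_Suc)
  show ?thesis using p m
    by (simp add: upt_rec numeral_eq_Suc fps_mult_nth num_partitions_eq num_even_partitions_eq
        del: One_nat_def)
qed

section \<open>Conjugacy classes of the alternating group\<close>

lemma weight_simps [simp]:
  "weight {#} = 0"
  "weight (add_mset c M) = c div 2 + weight M"
  by (simp_all add: weight_def)

text \<open>The bound \<open>N\<close> on the points used leaves room for further cycles on
  intervals starting at \<open>N\<close>.\<close>

definition realizable :: "nat multiset \<Rightarrow> bool" where
  "realizable M \<longleftrightarrow> (\<exists>css ws N. disjoint_cycles css \<and> set (concat css) \<subseteq> {..<N} \<and>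
     mset (map length css) = M \<and> comp_cycles css = comp_list ws \<and>
     set ws \<subseteq> S_Alt_N \<and> length ws = weight M)"

lemma realizable_empty: "realizable {#}"
  unfolding realizable_def by (rule exI[of _ "[]"], rule exI[of _ "[]"]) auto

lemma realizable_add_odd:
  assumes "realizable M" "odd c" "2 \<le> c"
  shows "realizable (add_mset c M)"
proof -
  obtain css ws N where M: "disjoint_cycles css" "set (concat css) \<subseteq> {..<N}"
    "mset (map length css) = M" "comp_cycles css = comp_list ws"
    "set ws \<subseteq> S_Alt_N" "length ws = weight M"
    using assms(1) unfolding realizable_def by blast
  obtain m where c: "c = 2 * m + 1" using assms(2) by (auto elim: oddE)
  let ?cs = "[N..<N + 2 * m + 1]"
  have "disjoint_cycles (?cs # css)"
    using M(1,2) assms(3) c by (auto simp: disjoint_cycles_Cons simp del: upt_Suc)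
  moreover have "set (concat (?cs # css)) \<subseteq> {..<N + 2 * m + 1}"
    using M(2) by (auto simp del: upt_Suc)
  moreover have "mset (map length (?cs # css)) = add_mset c M"
    using M(3) c by (simp del: upt_Suc)
  moreover have "comp_cycles (?cs # css) = comp_list (triples N m @ ws)"
    using M(4) comp_list_triples[of N m] by (simp only: list.map comp_list_simps comp_list_append)
  moreover have "set (triples N m @ ws) \<subseteq> S_Alt_N" using M(5) set_triples by simp
  moreover have "length (triples N m @ ws) = weight (add_mset c M)" using M(6) c by simp
  ultimately show ?thesis unfolding realizable_def by blast
qed

lemma realizable_add_even_even:
  assumes "realizable M" "even c" "2 \<le> c" "even d" "2 \<le> d"
  shows "realizable (add_mset c (add_mset d M))"
proof -
  obtain css ws N where M: "disjoint_cycles css" "set (concat css) \<subseteq> {..<N}"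
    "mset (map length css) = M" "comp_cycles css = comp_list ws"
    "set ws \<subseteq> S_Alt_N" "length ws = weight M"
    using assms(1) unfolding realizable_def by blast
  \<comment> \<open>The word below then has \<open>a + 1 + 1 + b = c div 2 + d div 2\<close>
    letters, exactly the weight of the two new cycles.\<close>
  define a where "a = c div 2 - 1"
  define b where "b = d div 2 - 1"
  have c: "c = 2 * a + 2" and d: "d = 2 * b + 2"
    using assms by (auto simp: a_def b_def elim!: evenE)
  let ?cs = "[N..<N + 2 * a + 2]" and ?ds = "[N + 2 * a + 2..<N + 2 * a + 2 * b + 4]"
  let ?us = "triples N a @ cycle_of_list [N + 2 * a, N + 2 * a + 1, N + 2 * a + 2] #
      triples (N + 2 * a + 1) 1 @ triples (N + 2 * a + 3) b"
  have "disjoint_cycles (?cs # ?ds # css)"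
    using M(1,2) by (auto simp: disjoint_cycles_Cons simp del: upt_Suc)
  moreover have "set (concat (?cs # ?ds # css)) \<subseteq> {..<N + 2 * a + 2 * b + 4}"
    using M(2) by (auto simp del: upt_Suc)
  moreover have "mset (map length (?cs # ?ds # css)) = add_mset c (add_mset d M)"
    using M(3) c d by (simp del: upt_Suc)
  moreover have "comp_cycles (?cs # ?ds # css) = comp_list (?us @ ws)"
    unfolding comp_list_append[of ?us] even_cycle_pair_word
    using M(4) by (simp only: list.map comp_list_simps comp_assoc)
  moreover have "set (?us @ ws) \<subseteq> S_Alt_N"
  proof -
    have "cycle_of_list [N + 2 * a, N + 2 * a + 1, N + 2 * a + 2] \<in> S_Alt_N"
      unfolding S_Alt_N_def by blast
    then show ?thesis using M(5) set_triples by (simp del: cycle_of_list.simps)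
  qed
  moreover have "length (?us @ ws) = weight (add_mset c (add_mset d M))" using M(6) c d by simp
  ultimately show ?thesis unfolding realizable_def by blast
qed

text \<open>Remove one odd entry, or two even ones: the parity hypothesis ensures that an even entry
  never occurs alone.\<close>

lemma realizableI:
  assumes "\<forall>c\<in>#M. 2 \<le> c" "even (size (filter_mset even M))"
  shows "realizable M"
  using assms
proof (induction "size M" arbitrary: M rule: less_induct)
  case less
  consider (odd) c where "c \<in># M" "odd c" | (even) c where "c \<in># M" "even c" | "M = {#}"
    by (metis multiset_nonemptyE)
  then show ?case
  proof cases
    case odd
    then obtain M' where "M = add_mset c M'" by (auto dest: multi_member_split)
    then show ?thesis using less odd realizable_add_odd by simp
  next
    case even
    then obtain M' where M': "M = add_mset c M'" by (auto dest: multi_member_split)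
    then have "odd (size (filter_mset even M'))" using less.prems(2) even(2) by simp
    then have "filter_mset even M' \<noteq> {#}" by (metis even_zero size_empty)
    then obtain d where "d \<in># filter_mset even M'" by (meson multiset_nonemptyE)
    then have d: "d \<in># M'" "even d" by simp_all
    then obtain M'' where "M' = add_mset d M''" by (auto dest: multi_member_split)
    then show ?thesis using M' less even(2) d(2) realizable_add_even_even by simp
  qed (simp add: realizable_empty)
qed

lemma cycle_type_word:
  assumes "\<forall>c\<in>#M. 2 \<le> c" "even (size (filter_mset even M))"
  obtains ws where "set ws \<subseteq> S_Alt_N" "length ws = weight M" "cycle_type (comp_list ws) = M"
proof -
  obtain css ws where "disjoint_cycles css" "mset (map length css) = M"
    "comp_cycles css = comp_list ws" "set ws \<subseteq> S_Alt_N" "length ws = weight M"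
    using realizableI[OF assms] unfolding realizable_def by blast
  then show thesis using that cycle_type_comp_cycles by metis
qed

section \<open>Conjugacy and words in the group\<close>

interpretation Alt_N: group Alt_N
  by (rule Alt_N_is_group)

lemma carrier_Alt_N: "p \<in> carrier Alt_N \<longleftrightarrow> permutation p \<and> evenperm p"
  by (simp add: Alt_N_def)

lemma inv_Alt_N:
  assumes "p \<in> carrier Alt_N"
  shows "inv\<^bsub>Alt_N\<^esub> p = inv' p"
proof (rule Alt_N.inv_equality)
  have p: "permutation p" "evenperm p" using assms by (simp_all add: carrier_Alt_N)
  then show "inv' p \<otimes>\<^bsub>Alt_N\<^esub> p = \<one>\<^bsub>Alt_N\<^esub>"
    by (simp add: Alt_N_def permutation_inverse_works)
  show "inv' p \<in> carrier Alt_N" using p by (simp add: carrier_Alt_N permutation_inverse evenperm_inv)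
qed fact

lemma foldr_mult_Alt_N: "foldr (\<otimes>\<^bsub>Alt_N\<^esub>) ws \<one>\<^bsub>Alt_N\<^esub> = comp_list ws"
  by (simp add: Alt_N_def comp_list_def)

definition Alt_N_with_cycle_type :: "nat multiset \<Rightarrow> (nat \<Rightarrow> nat) set" where
  "Alt_N_with_cycle_type M = {p \<in> carrier Alt_N. cycle_type p = M}"

text \<open>Conjugation preserves the cycle type, and permutations of equal type have an even
  conjugator. So no cycle type splits into several classes, unlike in finite alternating
  groups.\<close>

lemma conj_class_Alt_N:
  assumes "p \<in> carrier Alt_N"
  shows "conj_class Alt_N p = Alt_N_with_cycle_type (cycle_type p)"
proof -
  have p: "permutation p" using assms by (simp add: carrier_Alt_N)
  have conj: "conj_action Alt_N h p = h \<circ> p \<circ> inv' h" if "h \<in> carrier Alt_N" for h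
    using that assms inv_Alt_N by (simp add: conj_action_def Alt_N_def)
  show ?thesis
  proof (intro equalityI subsetI)
    fix q assume "q \<in> conj_class Alt_N p"
    then obtain h where h: "h \<in> carrier Alt_N" "q = conj_action Alt_N h p"
      by (auto simp: conj_class_def Group_Action.orbit_def)
    then have "q \<in> carrier Alt_N" using assms by (simp add: conj_action_def)
    moreover have "cycle_type q = cycle_type p"
      using h conj cycle_type_conj[OF permutation_bijective p] by (simp add: carrier_Alt_N)
    ultimately show "q \<in> Alt_N_with_cycle_type (cycle_type p)"
      by (simp add: Alt_N_with_cycle_type_def)
  next
    fix q assume "q \<in> Alt_N_with_cycle_type (cycle_type p)"
    then have "permutation q" "cycle_type p = cycle_type q"
      by (simp_all add: Alt_N_with_cycle_type_def carrier_Alt_N)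
    then obtain h where h: "permutation h" "evenperm h" "q = h \<circ> p \<circ> inv' h"
      using conj_if_cycle_type_eq[OF p] infinite_UNIV_nat by blast
    then have "h \<in> carrier Alt_N" "q = conj_action Alt_N h p"
      using conj by (simp_all add: carrier_Alt_N)
    then show "q \<in> conj_class Alt_N p" unfolding conj_class_def Group_Action.orbit_def by blast
  qed
qed

text \<open>Used to see that inverses of generators are again 3-cycles.\<close>

lemma inv_three_cycle: "inv' (cycle_of_list [a, b, c]) = cycle_of_list [c, b, a]"
  by (rule inv_unique_comp) (auto simp: fun_eq_iff transpose_commute)

text \<open>Ensures that the minimum defining \<open>word_length\<close> is attained by an actual
  word.\<close>

lemma generate_word:
  assumes "group G" "S \<subseteq> carrier G" "g \<in> generate G S"
  shows "\<exists>ws. set ws \<subseteq> S \<union> m_inv G ` S \<and> foldr (\<otimes>\<^bsub>G\<^esub>) ws \<one>\<^bsub>G\<^esub> = g"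
  using assms(3)
proof (induction rule: generate.induct)
  interpret group G by fact
  have closed: "foldr (\<otimes>\<^bsub>G\<^esub>) ws x \<in> carrier G"
    if "set ws \<subseteq> S \<union> m_inv G ` S" "x \<in> carrier G" for ws x
    using that assms(2) by (induction ws) auto
  have append: "foldr (\<otimes>\<^bsub>G\<^esub>) ws x = foldr (\<otimes>\<^bsub>G\<^esub>) ws \<one>\<^bsub>G\<^esub> \<otimes>\<^bsub>G\<^esub> x"
    if "set ws \<subseteq> S \<union> m_inv G ` S" "x \<in> carrier G" for ws x
    using that
  proof (induction ws)
    case (Cons w ws)
    then have "w \<in> carrier G" using assms(2) by auto
    then show ?case using Cons closed[of ws] by (simp add: m_assoc)
  qed simp
  { case one show ?case by (rule exI[of _ "[]"]) simp }
  { case (incl h) then show ?case using assms(2) by (intro exI[of _ "[h]"]) auto }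
  { case (inv h) then show ?case using assms(2) by (intro exI[of _ "[inv\<^bsub>G\<^esub> h]"]) auto }
  { case (eng g h)
    then obtain us vs where "set us \<subseteq> S \<union> m_inv G ` S" "foldr (\<otimes>\<^bsub>G\<^esub>) us \<one>\<^bsub>G\<^esub> = g"
      "set vs \<subseteq> S \<union> m_inv G ` S" "foldr (\<otimes>\<^bsub>G\<^esub>) vs \<one>\<^bsub>G\<^esub> = h" by blast
    then show ?case
      using append[of us h] closed[of vs "\<one>\<^bsub>G\<^esub>"] by (intro exI[of _ "us @ vs"]) auto }
qed

section \<open>Counting cycle types of even permutations by weight\<close>

definition even_cycle_types :: "nat \<Rightarrow> nat multiset set" where
  "even_cycle_types n = {M. (\<forall>c\<in>#M. 2 \<le> c) \<and> even (size (filter_mset even M)) \<and> weight M = n}"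

text \<open>An odd cycle of length \<open>2m + 1\<close> becomes a part \<open>m\<close> of the first partition, an even cycle of
  length \<open>2m\<close> a part \<open>m\<close> of the second.\<close>

definition join_partitions :: "nat multiset \<Rightarrow> nat multiset \<Rightarrow> nat multiset" where
  "join_partitions P Q = image_mset (\<lambda>m. 2 * m + 1) P + image_mset (\<lambda>m. 2 * m) Q"

lemma weight_join_partitions: "weight (join_partitions P Q) = sum_mset P + sum_mset Q"
proof -
  have "weight (image_mset (\<lambda>m. 2 * m + 1) P) = sum_mset P" by (induction P) auto
  moreover have "weight (image_mset (\<lambda>m. 2 * m) Q) = sum_mset Q" by (induction Q) auto
  ultimately show ?thesis by (simp add: join_partitions_def weight_def)
qed

lemma filter_join_partitions:
  "filter_mset odd (join_partitions P Q) = image_mset (\<lambda>m. 2 * m + 1) P"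
  "filter_mset even (join_partitions P Q) = image_mset (\<lambda>m. 2 * m) Q"
proof -
  have "filter_mset odd (image_mset (\<lambda>m. 2 * m + 1) P) = image_mset (\<lambda>m. 2 * m + 1) P"
    "filter_mset even (image_mset (\<lambda>m. 2 * m + 1) P) = {#}" by (induction P) auto
  moreover have "filter_mset odd (image_mset (\<lambda>m. 2 * m) Q) = {#}"
    "filter_mset even (image_mset (\<lambda>m. 2 * m) Q) = image_mset (\<lambda>m. 2 * m) Q" by (induction Q) auto
  ultimately show "filter_mset odd (join_partitions P Q) = image_mset (\<lambda>m. 2 * m + 1) P"
    "filter_mset even (join_partitions P Q) = image_mset (\<lambda>m. 2 * m) Q"
    by (simp_all add: join_partitions_def)
qed

lemma join_partitions_split:
  "join_partitions (image_mset (\<lambda>c. c div 2) (filter_mset odd M))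
    (image_mset (\<lambda>c. c div 2) (filter_mset even M)) = M"
  by (induction M) (auto simp: join_partitions_def)

lemma split_join_partitions:
  "image_mset (\<lambda>c. c div 2) (filter_mset odd (join_partitions P Q)) = P"
  "image_mset (\<lambda>c. c div 2) (filter_mset even (join_partitions P Q)) = Q"
  unfolding filter_join_partitions by (simp_all add: image_mset.compositionality comp_def)

text \<open>The parity of an entry tells which partition it comes from, and halving recovers the
  part. The index \<open>i\<close>, the sum of \<open>P\<close>, is kept so that the domain has the
  shape of a Cauchy product.\<close>

lemma bij_betw_join_partitions:
  "bij_betw (\<lambda>(i, P, Q). join_partitions P Q)
    (SIGMA i:{0..n}. partitions i \<times> {Q \<in> partitions (n - i). even (size Q)})
    (even_cycle_types n)" (is "bij_betw _ ?A ?B")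
proof (rule bij_betw_byWitness[where f' = "\<lambda>M.
      (sum_mset (image_mset (\<lambda>c. c div 2) (filter_mset odd M)),
       image_mset (\<lambda>c. c div 2) (filter_mset odd M), image_mset (\<lambda>c. c div 2) (filter_mset even M))"])
  show "(\<lambda>(i, P, Q). join_partitions P Q) ` ?A \<subseteq> ?B"
  proof clarify
    fix i P Q
    assume *: "i \<in> {0..n}" "P \<in> partitions i" "Q \<in> partitions (n - i)" "even (size Q)"
    \<comment> \<open>Positive parts exclude the cycle lengths 0 and 1.\<close>
    have "2 \<le> c" if "c \<in># join_partitions P Q" for c
    proof -
      have "(\<exists>m. m \<in># P \<and> c = 2 * m + 1) \<or> (\<exists>m. m \<in># Q \<and> c = 2 * m)"
        using that by (auto simp: join_partitions_def)
      then obtain m where "m \<in># P \<and> c = 2 * m + 1 \<or> m \<in># Q \<and> c = 2 * m" by blast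
      then have "m \<noteq> 0" "c = 2 * m + 1 \<or> c = 2 * m"
        using * by (auto simp: partitions_def intro!: Nat.gr0I)
      then show ?thesis by linarith
    qed
    then show "join_partitions P Q \<in> even_cycle_types n"
      using * by (simp add: even_cycle_types_def filter_join_partitions weight_join_partitions partitions_def)
  qed
  show "(\<lambda>M. (sum_mset (image_mset (\<lambda>c. c div 2) (filter_mset odd M)),
      image_mset (\<lambda>c. c div 2) (filter_mset odd M), image_mset (\<lambda>c. c div 2) (filter_mset even M))) ` ?B \<subseteq> ?A"
  proof (intro image_subsetI)
    fix M assume M: "M \<in> even_cycle_types n"
    let ?P = "image_mset (\<lambda>c. c div 2) (filter_mset odd M)"
    let ?Q = "image_mset (\<lambda>c. c div 2) (filter_mset even M)"
    have "sum_mset ?P + sum_mset ?Q = n"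
      using M weight_join_partitions[of ?P ?Q] by (simp add: join_partitions_split even_cycle_types_def)
    moreover have "0 \<notin># ?P" "0 \<notin># ?Q" using M by (force simp: even_cycle_types_def)+
    moreover have "even (size ?Q)" using M by (simp add: even_cycle_types_def)
    ultimately show "(sum_mset ?P, ?P, ?Q) \<in> ?A" by (auto simp: partitions_def)
  qed
qed (auto simp: split_join_partitions join_partitions_split partitions_def)

lemma finite_even_cycle_types: "finite (even_cycle_types n)"
proof -
  have "finite (SIGMA i:{0..n}. partitions i \<times> {Q \<in> partitions (n - i). even (size Q)})"
    using finite_partitions by auto
  then show ?thesis using bij_betw_finite[OF bij_betw_join_partitions] by blast
qed

lemma card_even_cycle_types:
  "card (even_cycle_types n) = (\<Sum>i=0..n. num_partitions i * num_even_partitions (n - i))"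
proof -
  have "card (even_cycle_types n) =
    card (SIGMA i:{0..n}. partitions i \<times> {Q \<in> partitions (n - i). even (size Q)})"
    using bij_betw_same_card[OF bij_betw_join_partitions] by simp
  also have "\<dots> = (\<Sum>i=0..n. num_partitions i * num_even_partitions (n - i))"
    using finite_partitions
    by (subst card_SigmaI) (auto simp: num_partitions_def num_even_partitions_def card_cartesian_product)
  finally show ?thesis .
qed

section \<open>Conjugacy length and growth for a given generating set\<close>

context
  fixes S :: "(nat \<Rightarrow> nat) set"
  assumes generate: "generate Alt_N S = carrier Alt_N"
    and carrier: "S \<subseteq> carrier Alt_N"
    and lower: "S_Alt_N \<subseteq> S"
    and upper: "S \<subseteq> T_Alt_N"
begin

text \<open>A shortest word for \<open>p\<close> consists of 3-cycles, inverses included, so its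
  length bounds the weight.\<close>

lemma weight_le_word_length:
  assumes "p \<in> carrier Alt_N"
  shows "weight (cycle_type p) \<le> word_length Alt_N S p"
proof -
  have "\<exists>n ws. length ws = n \<and> set ws \<subseteq> S \<union> m_inv Alt_N ` S \<and>
      foldr (\<otimes>\<^bsub>Alt_N\<^esub>) ws \<one>\<^bsub>Alt_N\<^esub> = p"
    using generate_word[OF Alt_N_is_group carrier] assms generate by blast
  then have "\<exists>ws. length ws = word_length Alt_N S p \<and> set ws \<subseteq> S \<union> m_inv Alt_N ` S \<and>
      foldr (\<otimes>\<^bsub>Alt_N\<^esub>) ws \<one>\<^bsub>Alt_N\<^esub> = p"
    unfolding word_length_def by (rule LeastI_ex)
  then obtain ws where ws: "length ws = word_length Alt_N S p" "set ws \<subseteq> S \<union> m_inv Alt_N ` S"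
    "comp_list ws = p" unfolding foldr_mult_Alt_N by blast
  have "inv\<^bsub>Alt_N\<^esub> s \<in> T_Alt_N" if "s \<in> S" for s
  proof -
    have "s \<in> T_Alt_N" using \<open>s \<in> S\<close> upper by blast
    then obtain cs where cs: "s = cycle_of_list cs" "distinct cs" "length cs = 3"
      unfolding T_Alt_N_def by blast
    then obtain a b c where "cs = [a, b, c]" by (auto simp: numeral_3_eq_3 length_Suc_conv)
    have "s \<in> carrier Alt_N" using \<open>s \<in> S\<close> carrier by blast
    then have "inv\<^bsub>Alt_N\<^esub> s = inv' s" by (rule inv_Alt_N)
    also have "\<dots> = cycle_of_list [c, b, a]"
      unfolding cs(1) \<open>cs = [a, b, c]\<close> by (rule inv_three_cycle)
    finally have "inv\<^bsub>Alt_N\<^esub> s = cycle_of_list [c, b, a]" .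
    moreover have "distinct [c, b, a]" using cs(2) \<open>cs = [a, b, c]\<close> by auto
    moreover have "length [c, b, a] = 3" by simp
    ultimately show ?thesis unfolding T_Alt_N_def by blast
  qed
  then have "set ws \<subseteq> {cycle_of_list cs | cs. distinct cs \<and> length cs = 3}"
    using ws(2) upper unfolding T_Alt_N_def by blast
  from weight_cycle_type_le_length[OF this] show ?thesis unfolding ws(1,3) .
qed

lemma conj_length_Alt_N:
  assumes "p \<in> carrier Alt_N"
  shows "conj_length Alt_N S p = weight (cycle_type p)"
  unfolding conj_length_def
proof (rule Least_equality)
  have p: "permutation p" "evenperm p" using assms by (simp_all add: carrier_Alt_N)
  \<comment> \<open>The product of this word need not be \<open>p\<close>; having the same cycle
    type, it lies in the conjugacy class of \<open>p\<close>.\<close>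
  then obtain ws where ws: "set ws \<subseteq> S_Alt_N" "length ws = weight (cycle_type p)"
    "cycle_type (comp_list ws) = cycle_type p"
    using cycle_type_word cycle_type_ge_2 evenperm_iff_cycle_type by metis
  have "comp_list ws \<in> carrier Alt_N"
    using ws(1) lower carrier
  proof (induction ws)
    case (Cons w ws)
    then have "w \<otimes>\<^bsub>Alt_N\<^esub> comp_list ws \<in> carrier Alt_N" by (intro Alt_N.m_closed) auto
    moreover have "w \<otimes>\<^bsub>Alt_N\<^esub> comp_list ws = comp_list (w # ws)" by (simp add: Alt_N_def)
    ultimately show ?case by metis
  qed (simp add: Alt_N_def)
  then have "comp_list ws \<in> Alt_N_with_cycle_type (cycle_type p)"
    using ws(3) by (simp add: Alt_N_with_cycle_type_def)
  moreover have "word_length Alt_N S (comp_list ws) \<le> weight (cycle_type p)"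
    unfolding word_length_def
    by (rule Least_le) (use ws lower foldr_mult_Alt_N in blast)
  ultimately show "\<exists>h\<in>conj_class Alt_N p. word_length Alt_N S h = weight (cycle_type p)"
    using weight_le_word_length unfolding conj_class_Alt_N[OF assms]
    by (fastforce simp: Alt_N_with_cycle_type_def intro: antisym)
next
  fix n assume "\<exists>h\<in>conj_class Alt_N p. word_length Alt_N S h = n"
  then obtain h where "h \<in> carrier Alt_N" "cycle_type h = cycle_type p" "word_length Alt_N S h = n"
    unfolding conj_class_Alt_N[OF assms] by (auto simp: Alt_N_with_cycle_type_def)
  then show "weight (cycle_type p) \<le> n" using weight_le_word_length[of h] by simp
qed

lemma bij_betw_conj_classes_of_length:
  "bij_betw Alt_N_with_cycle_type (even_cycle_types n) (conj_classes_of_length Alt_N S n)"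
proof -
  \<comment> \<open>Injectivity relies on this: a common element of two classes forces equal cycle
    types.\<close>
  have nonempty: "\<exists>p. p \<in> Alt_N_with_cycle_type M" if "M \<in> even_cycle_types n" for M
  proof -
    have M: "\<forall>c\<in>#M. 2 \<le> c" "even (size (filter_mset even M))"
      using that by (simp_all add: even_cycle_types_def)
    obtain css :: "nat list list" where css: "disjoint_cycles css" "mset (map length css) = M"
      using realizableI[OF M] unfolding realizable_def by blast
    then have "cycle_type (comp_cycles css) = M" by (metis cycle_type_comp_cycles)
    then have "comp_cycles css \<in> Alt_N_with_cycle_type M"
      using evenperm_comp_cycles[OF css(1)] css(2) M(2) permutation_comp_cycles[of css]
      unfolding Alt_N_with_cycle_type_def carrier_Alt_N by simp
    then show ?thesis by blast
  qed
  have "inj_on Alt_N_with_cycle_type (even_cycle_types n)"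
  proof (rule inj_onI)
    fix M N assume "M \<in> even_cycle_types n" "Alt_N_with_cycle_type M = Alt_N_with_cycle_type N"
    then obtain p where "p \<in> Alt_N_with_cycle_type M" "p \<in> Alt_N_with_cycle_type N"
      using nonempty by blast
    then show "M = N" by (simp add: Alt_N_with_cycle_type_def)
  qed
  moreover have "Alt_N_with_cycle_type ` even_cycle_types n = conj_classes_of_length Alt_N S n"
  proof (intro equalityI subsetI)
    fix K assume "K \<in> Alt_N_with_cycle_type ` even_cycle_types n"
    then obtain M p where M: "M \<in> even_cycle_types n" "K = Alt_N_with_cycle_type M" "p \<in> K"
      using nonempty by blast
    then have p: "p \<in> carrier Alt_N" "cycle_type p = M" by (simp_all add: Alt_N_with_cycle_type_def)
    then have "K = conj_class Alt_N p" using conj_class_Alt_N M(2) by simp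
    then have "K \<in> conj_classes Alt_N"
      using p(1) unfolding conj_classes_def Group_Action.orbits_def conj_class_def by blast
    moreover have "conj_length Alt_N S q = n" if "q \<in> K" for q
      using that M(1,2) conj_length_Alt_N by (simp add: Alt_N_with_cycle_type_def even_cycle_types_def)
    ultimately show "K \<in> conj_classes_of_length Alt_N S n" by (simp add: conj_classes_of_length_def)
  next
    fix K assume K: "K \<in> conj_classes_of_length Alt_N S n"
    then obtain p where p: "p \<in> carrier Alt_N" "K = conj_class Alt_N p"
      by (auto simp: conj_classes_of_length_def conj_classes_def Group_Action.orbits_def conj_class_def)
    then have K_eq: "K = Alt_N_with_cycle_type (cycle_type p)" using conj_class_Alt_N by simp
    then have "p \<in> K" using p(1) by (simp add: Alt_N_with_cycle_type_def)
    then have "weight (cycle_type p) = n"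
      using K conj_length_Alt_N[OF p(1)] by (simp add: conj_classes_of_length_def)
    then have "cycle_type p \<in> even_cycle_types n"
      using p(1) cycle_type_ge_2 evenperm_iff_cycle_type
      by (auto simp: even_cycle_types_def carrier_Alt_N)
    then show "K \<in> Alt_N_with_cycle_type ` even_cycle_types n" using K_eq by blast
  qed
  ultimately show ?thesis by (simp add: bij_betw_def)
qed

lemma finite_conj_classes_of_length: "finite (conj_classes_of_length Alt_N S n)"
  using bij_betw_finite[OF bij_betw_conj_classes_of_length] finite_even_cycle_types by blast

lemma conj_growth_series_Alt_N:
  "conj_growth_series Alt_N S =
    Abs_fps (\<lambda>u. of_nat (num_partitions u)) * Abs_fps (\<lambda>v. of_nat (num_even_partitions v))"
proof (rule fps_ext)
  fix n
  have "card (conj_classes_of_length Alt_N S n) = card (even_cycle_types n)"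
    using bij_betw_same_card[OF bij_betw_conj_classes_of_length] by simp
  then show "fps_nth (conj_growth_series Alt_N S) n =
    fps_nth (Abs_fps (\<lambda>u. of_nat (num_partitions u)) * Abs_fps (\<lambda>v. of_nat (num_even_partitions v))) n"
    by (simp add: conj_growth_series_def fps_mult_nth card_even_cycle_types)
qed

end

theorem proposition11:
  fixes S :: "(nat \<Rightarrow> nat) set"
  assumes "S \<subseteq> carrier Alt_N"
    and "generate Alt_N S = carrier Alt_N"
    and "S_Alt_N \<subseteq> S"
    and "S \<subseteq> T_Alt_N"
  shows "(\<forall>n. finite (conj_classes_of_length Alt_N S n)) \<and>
    conj_growth_series Alt_N S =
      Abs_fps (\<lambda>u. of_nat (num_partitions u)) * Abs_fps (\<lambda>v. of_nat (num_even_partitions v)) \<and>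
    convergent_prod (\<lambda>j. 1 / (1 - fps_X ^ Suc j) ^ 2 :: rat fps) \<and>
    convergent_prod (\<lambda>j. 1 / (1 - fps_X ^ (2 * Suc j)) :: rat fps) \<and>
    conj_growth_series Alt_N S =
      fps_const (1 / 2) * (\<Prod>j. 1 / (1 - fps_X ^ Suc j) ^ 2) +
      fps_const (1 / 2) * (\<Prod>j. 1 / (1 - fps_X ^ (2 * Suc j))) \<and>
    map (fps_nth (conj_growth_series Alt_N S)) [0..<11] =
      [1, 1, 3, 5, 11, 18, 34, 55, 95, 150, 244]"
proof (intro conjI)
  note S = assms(2,1,3,4)
  show "\<forall>n. finite (conj_classes_of_length Alt_N S n)"
    using finite_conj_classes_of_length[OF S] ..
  show series: "conj_growth_series Alt_N S =
      Abs_fps (\<lambda>u. of_nat (num_partitions u)) * Abs_fps (\<lambda>v. of_nat (num_even_partitions v))"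
    by (rule conj_growth_series_Alt_N[OF S])
  show "convergent_prod (\<lambda>j. 1 / (1 - fps_X ^ Suc j) ^ 2 :: rat fps)"
    unfolding fps_inverse_square by (rule prod_partition_series_mult)
  show "convergent_prod (\<lambda>j. 1 / (1 - fps_X ^ (2 * Suc j)) :: rat fps)"
    unfolding fps_inverse_difference_of_squares by (rule prod_partition_series_mult)
  show "conj_growth_series Alt_N S =
      fps_const (1 / 2) * (\<Prod>j. 1 / (1 - fps_X ^ Suc j) ^ 2) +
      fps_const (1 / 2) * (\<Prod>j. 1 / (1 - fps_X ^ (2 * Suc j)))"
    unfolding series by (rule partition_series_identity)
  show "map (fps_nth (conj_growth_series Alt_N S)) [0..<11] =
      [1, 1, 3, 5, 11, 18, 34, 55, 95, 150, 244]"
    unfolding series by (rule partition_series_product_coeffs)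
qed

end
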